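(* Let $H$ be a complex Hilbert space and let $0<p<\infty$. Let $e,v,e',v'\in\mathcal U_{\min}(H)$. If $$\|\lambda e-v\|_p=\|\lambda e'-v'\|_p\qquad\text{for all }\lambda\in\mathbb T,$$ then $$\mathrm{Tr}(e^*v)=\mathrm{Tr}((e')^*v').$$
   Context: $\mathcal U_{\min}(H)$ is the set of minimal (i.e. rank-one) partial isometries on $H$, that is, the operators $\eta\otimes\xi: a\mapsto\langle a,\xi\rangle\eta$ with $\eta,\xi\in H$ unit vectors. $\mathbb T=\{\lambda\in\mathbb C:|\lambda|=1\}$. $\mathrm{Tr}$ is the standard trace, and $\|x\|_p=(\mathrm{Tr}(|x|^p))^{1/p}$ is the Schatten $p$-(quasi-)norm, i.e. the $\ell_p$-(quasi-)norm of the sequence of singular values of $x$. *)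

theory Defs
  imports "HOL-Analysis.Analysis"
begin

text \<open>
  Complex Hilbert spaces, of arbitrary dimension. The inner product is linear in its \<^emph>\<open>first\<close>
  argument. Both the norm and the real scalar multiplication inherited from \<^class>\<open>banach\<close> are
  tied to the complex structure; completeness is inherited from \<^class>\<open>banach\<close>.
\<close>

class chilbert_space = banach +
  fixes scaleC :: "complex \<Rightarrow> 'a \<Rightarrow> 'a"  (infixr \<open>*\<^sub>C\<close> 75)
    and cinner :: "'a \<Rightarrow> 'a \<Rightarrow> complex"
  assumes scaleC_add_right: "c *\<^sub>C (x + y) = c *\<^sub>C x + c *\<^sub>C y"
    and scaleC_add_left: "(c + d) *\<^sub>C x = c *\<^sub>C x + d *\<^sub>C x"
    and scaleC_scaleC: "c *\<^sub>C d *\<^sub>C x = (c * d) *\<^sub>C x"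
    and scaleR_scaleC: "r *\<^sub>R x = complex_of_real r *\<^sub>C x"
    and cinner_add_left: "cinner (x + y) z = cinner x z + cinner y z"
    and cinner_scaleC_left: "cinner (c *\<^sub>C x) y = c * cinner x y"
    and cinner_commute: "cinner x y = cnj (cinner y x)"
    and cinner_self: "cinner x x = complex_of_real ((norm x)\<^sup>2)"

global_interpretation complex_vector:
  vector_space "scaleC :: complex \<Rightarrow> 'a \<Rightarrow> 'a::chilbert_space"
proof
  fix x :: 'a
  have "1 *\<^sub>C x = 1 *\<^sub>R x"
    by (simp add: scaleR_scaleC)
  then show "1 *\<^sub>C x = x"
    by simp
qed (simp_all add: scaleC_add_right scaleC_add_left scaleC_scaleC)

instantiation complex :: chilbert_space
begin

definition "c *\<^sub>C (x::complex) = c * x"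
definition "cinner (x::complex) y = x * cnj y"

instance
  by standard
    (simp_all add: scaleC_complex_def cinner_complex_def algebra_simps scaleR_conv_of_real
      complex_norm_square [symmetric])

end

definition bounded_clinear :: "('a::chilbert_space \<Rightarrow> 'a) \<Rightarrow> bool" where
  "bounded_clinear A \<longleftrightarrow> bounded_linear A \<and> (\<forall>c x. A (c *\<^sub>C x) = c *\<^sub>C A x)"

definition rank_one :: "'a::chilbert_space \<Rightarrow> 'a \<Rightarrow> 'a \<Rightarrow> 'a" where
  "rank_one \<eta> \<xi> = (\<lambda>a. cinner a \<xi> *\<^sub>C \<eta>)"

definition min_partial_isometries :: "('a::chilbert_space \<Rightarrow> 'a) set" where
  "min_partial_isometries = {rank_one \<eta> \<xi> | \<eta> \<xi>. norm \<eta> = 1 \<and> norm \<xi> = 1}"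

text \<open>For bounded operators the Riesz theorem gives existence and uniqueness of the adjoint.\<close>

definition cadjoint :: "('a::chilbert_space \<Rightarrow> 'a) \<Rightarrow> 'a \<Rightarrow> 'a" where
  "cadjoint A = (THE B. \<forall>x y. cinner (A x) y = cinner x (B y))"

definition is_orthonormal_basis :: "'a::chilbert_space set \<Rightarrow> bool" where
  "is_orthonormal_basis B \<longleftrightarrow>
     (\<forall>b\<in>B. norm b = 1) \<and> (\<forall>b\<in>B. \<forall>c\<in>B. b \<noteq> c \<longrightarrow> cinner b c = 0) \<and>
     closure (complex_vector.span B) = UNIV"

text \<open>
  The trace is the common value of the diagonal sums over all orthonormal bases. It is meaningful
  exactly for trace-class operators, since \<^const>\<open>has_sum\<close> in the complex numbers is absolute
  convergence.
\<close>

definition op_trace :: "('a::chilbert_space \<Rightarrow> 'a) \<Rightarrow> complex" where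
  "op_trace A =
     (THE t. \<forall>B. is_orthonormal_basis B \<longrightarrow> ((\<lambda>b. cinner (A b) b) has_sum t) B)"

definition positive_op :: "('a::chilbert_space \<Rightarrow> 'a) \<Rightarrow> bool" where
  "positive_op A \<longleftrightarrow> bounded_clinear A \<and> (\<forall>x. cinner (A x) x \<in> \<real> \<and> 0 \<le> Re (cinner (A x) x))"

text \<open>The modulus \<open>|A|\<close>: the unique positive square root of \<open>A\<^sup>*A\<close>.\<close>

definition op_modulus :: "('a::chilbert_space \<Rightarrow> 'a) \<Rightarrow> 'a \<Rightarrow> 'a" where
  "op_modulus A = (THE P. positive_op P \<and> P \<circ> P = cadjoint A \<circ> A)"

text \<open>
  The nonzero singular values, i.e. the nonzero eigenvalues of \<open>|A|\<close>, which are real and positive,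
  with their multiplicities.
\<close>

definition singular_values :: "('a::chilbert_space \<Rightarrow> 'a) \<Rightarrow> real set" where
  "singular_values A = {s. 0 < s \<and> (\<exists>x. x \<noteq> 0 \<and> op_modulus A x = complex_of_real s *\<^sub>C x)}"

definition singular_value_mult :: "('a::chilbert_space \<Rightarrow> 'a) \<Rightarrow> real \<Rightarrow> nat" where
  "singular_value_mult A s = complex_vector.dim {x. op_modulus A x = complex_of_real s *\<^sub>C x}"

text \<open>
  \<open>(Tr |A|\<^sup>p)\<^bsup>1/p\<^esup>\<close>, as the \<open>\<ell>\<^sub>p\<close> (quasi-)norm of the singular values repeated according to
  multiplicity. It is meant for \<open>p > 0\<close> and \<open>A\<close> in the Schatten \<open>p\<close>-class (in particular for finite
  rank \<open>A\<close>); such \<open>A\<close> are compact, so every multiplicity is finite.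
\<close>

definition schatten_norm :: "real \<Rightarrow> ('a::chilbert_space \<Rightarrow> 'a) \<Rightarrow> real" where
  "schatten_norm p A =
     (\<Sum>\<^sub>\<infinity>s\<in>singular_values A. real (singular_value_mult A s) * s powr p) powr (1 / p)"

end

theory Submission
  imports Defs
begin

text \<open>
  Write \<open>e = rank_one u x\<close>, \<open>v = rank_one w y\<close> and \<open>\<tau> = cinner w u * cinner x y\<close>, which is the
  trace of \<open>e\<^sup>*v\<close>. For \<open>\<bar>\<lambda>\<bar> = 1\<close> the squared singular values \<open>a, b\<close> of \<open>\<lambda>e - v\<close> satisfy
  \<open>a + b = 2 - 2 Re (cnj \<lambda> \<tau>)\<close>, while \<open>a b = d\<close> does not depend on \<open>\<lambda>\<close>, and the
  \<open>p\<close>-th power of the Schatten norm is \<open>a\<^sup>q + b\<^sup>q\<close> with \<open>q = p/2\<close>. Given \<open>d\<close>, this value determines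
  \<open>a + b\<close>, because the numbers \<open>a\<^sup>q, b\<^sup>q\<close> have a known sum and product. Choose a unit \<open>\<omega>\<close> with
  \<open>\<tau> = \<bar>\<tau>\<bar> \<omega>\<close>. The norms at \<open>\<lambda> = \<plusminus>\<i>\<omega>\<close> agree for \<open>(e, v)\<close>, hence for \<open>(e', v')\<close>, so \<open>\<tau>'\<close> is a real
  multiple of \<open>\<omega>\<close>. At \<open>\<lambda> = \<i>\<omega>\<close> both pairs then have \<open>a + b = 2\<close>, and if \<open>q \<noteq> 1\<close> the strict convexity
  or concavity of the \<open>q\<close>-th power gives \<open>d = d'\<close>. The norm at \<open>\<lambda> = \<omega>\<close> now yields
  \<open>\<bar>\<tau>\<bar> = Re (cnj \<omega> \<tau>')\<close>. For \<open>q = 1\<close> this last step does not need \<open>d = d'\<close>.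
\<close>

section \<open>Complex inner products and orthonormal families\<close>

lemma cinner_add_right: "cinner x (y + z) = cinner x y + cinner x (z::'a::chilbert_space)"
  by (metis cinner_commute cinner_add_left complex_cnj_add)

lemma cinner_scaleC_right: "cinner x (c *\<^sub>C y) = cnj c * cinner x (y::'a::chilbert_space)"
  by (metis cinner_commute cinner_scaleC_left complex_cnj_mult)

lemma additive_cinner_left: "Modules.additive (\<lambda>x. cinner x (y::'a::chilbert_space))"
  by (simp add: Modules.additive_def cinner_add_left)

lemma additive_cinner_right: "Modules.additive (\<lambda>y. cinner (x::'a::chilbert_space) y)"
  by (simp add: Modules.additive_def cinner_add_right)

lemmas cinner_diff_left = Modules.additive.diff [OF additive_cinner_left]
lemmas cinner_diff_right = Modules.additive.diff [OF additive_cinner_right]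
lemmas cinner_minus_left = Modules.additive.minus [OF additive_cinner_left]
lemmas cinner_sum_left = Modules.additive.sum [OF additive_cinner_left]
lemmas cinner_sum_right = Modules.additive.sum [OF additive_cinner_right]
lemmas cinner_zero_left [simp] = Modules.additive.zero [OF additive_cinner_left]
lemmas cinner_zero_right [simp] = Modules.additive.zero [OF additive_cinner_right]

lemmas cinner_linear = cinner_add_left cinner_add_right cinner_diff_left cinner_diff_right
  cinner_scaleC_left cinner_scaleC_right

lemma cinner_eq_zero_iff: "cinner x x = 0 \<longleftrightarrow> x = (0::'a::chilbert_space)"
  by (simp add: cinner_self)

lemma of_real_cmod_power2: "(complex_of_real (cmod z))\<^sup>2 = z * cnj z"
  by (metis complex_norm_square of_real_power)

lemma norm_scaleC: "norm (c *\<^sub>C x) = cmod c * norm (x::'a::chilbert_space)"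
proof -
  have "complex_of_real ((norm (c *\<^sub>C x))\<^sup>2) = of_real ((cmod c * norm x)\<^sup>2)"
    using cinner_self [of "c *\<^sub>C x"]
    by (simp add: cinner_linear cinner_self [of x] power_mult_distrib of_real_cmod_power2 mult_ac)
  then show ?thesis
    using of_real_eq_iff by (metis mult_nonneg_nonneg norm_ge_zero power2_eq_iff_nonneg)
qed

text \<open>Cauchy-Schwarz: the component of \<open>x\<close> orthogonal to \<open>y\<close> has
  non-negative squared norm.\<close>

lemma norm_cinner_le: "cmod (cinner x y) \<le> norm x * norm (y::'a::chilbert_space)"
proof (cases "y = 0")
  case False
  define c where "c = cinner x y / of_real ((norm y)\<^sup>2)"
  have c: "c * cinner y y = cinner x y"
    using False by (simp add: c_def cinner_self)
  have "cinner (x - c *\<^sub>C y) (x - c *\<^sub>C y) = cinner x x - c * cinner y x"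
    using c by (simp add: cinner_linear algebra_simps)
  also have "\<dots> = of_real ((norm x)\<^sup>2 - (cmod (cinner x y))\<^sup>2 / (norm y)\<^sup>2)"
    using cinner_commute [of y x]
    by (simp add: c_def cinner_self of_real_cmod_power2)
  finally have "(norm x)\<^sup>2 - (cmod (cinner x y))\<^sup>2 / (norm y)\<^sup>2 = (norm (x - c *\<^sub>C y))\<^sup>2"
    unfolding cinner_self by (metis of_real_eq_iff)
  then have "(cmod (cinner x y))\<^sup>2 / (norm y)\<^sup>2 \<le> (norm x)\<^sup>2"
    by (metis diff_ge_0_iff_ge zero_le_power2)
  then have "(cmod (cinner x y))\<^sup>2 \<le> (norm x * norm y)\<^sup>2"
    using False by (simp add: divide_simps power_mult_distrib)
  then show ?thesis
    by (rule power2_le_imp_le) simp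
qed simp

section \<open>Rank-one operators, adjoints and symmetry of positive operators\<close>

lemma bounded_linear_rank_one: "bounded_linear (rank_one \<eta> (\<xi>::'a::chilbert_space))"
proof
  show "rank_one \<eta> \<xi> (x + y) = rank_one \<eta> \<xi> x + rank_one \<eta> \<xi> y" for x y
    by (simp add: rank_one_def cinner_linear scaleC_add_left)
  show "rank_one \<eta> \<xi> (r *\<^sub>R x) = r *\<^sub>R rank_one \<eta> \<xi> x" for r x
    by (simp add: rank_one_def scaleR_scaleC cinner_linear scaleC_scaleC)
  have "norm (rank_one \<eta> \<xi> x) \<le> norm x * (norm \<xi> * norm \<eta>)" for x
    using mult_right_mono [OF norm_cinner_le [of x \<xi>], of "norm \<eta>"]
    by (simp add: rank_one_def norm_scaleC mult.assoc)
  then show "\<exists>K. \<forall>x. norm (rank_one \<eta> \<xi> x) \<le> norm x * K"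
    by blast
qed

text \<open>An adjoint is supplied, so only uniqueness is at stake: the difference of two candidates
  at \<open>y\<close> is orthogonal to every vector, in particular to itself.\<close>

lemma cadjoint_eqI:
  assumes "\<And>x y. cinner (A x) y = cinner x (B (y::'a::chilbert_space))"
  shows "cadjoint A = B"
  unfolding cadjoint_def
proof (rule the_equality)
  fix C assume C: "\<forall>x y. cinner (A x) y = cinner x (C y)"
  have "cinner (C y - B y) (C y - B y) = 0" for y
    using C assms by (metis cinner_diff_right eq_iff_diff_eq_0)
  then show "C = B"
    by (auto simp: cinner_eq_zero_iff)
qed (use assms in blast)

text \<open>Polarisation: the quadratic form is real, and its values at \<open>x + y\<close> and
  \<open>x + \<i> *\<^sub>C y\<close> control the imaginary and the real part of
  \<open>cinner (P x) y\<close>.\<close>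

lemma positive_op_self_adjoint:
  assumes "positive_op (P::'a::chilbert_space \<Rightarrow> 'a)"
  shows "cinner (P x) y = cinner x (P y)"
proof -
  have add: "P (x + y) = P x + P y" and scale: "P (c *\<^sub>C x) = c *\<^sub>C P x" for x y c
    using assms by (auto simp: positive_op_def bounded_clinear_def linear_simps)
  have real: "Im (cinner (P x) x) = 0" for x
    using assms by (simp add: positive_op_def complex_is_Real_iff)
  have "Im (cinner (P x) y + cinner (P y) x) = 0"
    using real [of "x + y"] real [of x] real [of y] by (simp add: add cinner_linear)
  moreover have "Re (cinner (P x) y) = Re (cinner (P y) x)"
    using real [of "x + \<i> *\<^sub>C y"] real [of x] real [of y]
    by (simp add: add scale cinner_linear)
  ultimately have "cinner (P x) y = cnj (cinner (P y) x)"
    by (simp add: complex_eq_iff)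
  then show ?thesis
    by (metis cinner_commute)
qed

section \<open>Orthonormal families, best approximation and Parseval's identity\<close>

definition orthonormal :: "'a::chilbert_space set \<Rightarrow> bool" where
  "orthonormal F \<longleftrightarrow> (\<forall>b\<in>F. norm b = 1) \<and> (\<forall>b\<in>F. \<forall>c\<in>F. b \<noteq> c \<longrightarrow> cinner b c = 0)"

lemma orthonormal_cinner:
  assumes "orthonormal F" "b \<in> F" "c \<in> F"
  shows "cinner b c = (if b = c then 1 else 0)"
  using assms by (auto simp: orthonormal_def cinner_self)

lemma orthonormal_subset: "orthonormal F \<Longrightarrow> G \<subseteq> F \<Longrightarrow> orthonormal G"
  by (auto simp: orthonormal_def)

lemma is_orthonormal_basis_imp_orthonormal: "is_orthonormal_basis B \<Longrightarrow> orthonormal B"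
  by (simp add: is_orthonormal_basis_def orthonormal_def)

lemma cinner_sum_orthonormal:
  assumes "orthonormal F" "finite F" "f \<in> F"
  shows "cinner (\<Sum>g\<in>F. c g *\<^sub>C g) f = c f"
proof -
  have "cinner (\<Sum>g\<in>F. c g *\<^sub>C g) f = (\<Sum>g\<in>F. if g = f then c g else 0)"
    unfolding cinner_sum_left using assms(1,3)
    by (intro sum.cong) (auto simp: cinner_linear orthonormal_cinner)
  also have "\<dots> = c f"
    using assms by simp
  finally show ?thesis .
qed

text \<open>Serves to read off multiplicities: an eigenspace spanned by a finite orthonormal family
  has dimension equal to its cardinality.\<close>

lemma orthonormal_independent:
  assumes "orthonormal F"
  shows "complex_vector.independent F"
proof
  assume "complex_vector.dependent F"
  then obtain G u v where G: "finite G" "G \<subseteq> F" "v \<in> G" "u v \<noteq> 0" "(\<Sum>w\<in>G. u w *\<^sub>C w) = 0"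
    unfolding complex_vector.dependent_explicit by blast
  then have "u v = cinner (\<Sum>w\<in>G. u w *\<^sub>C w) v"
    using cinner_sum_orthonormal orthonormal_subset [OF assms] by metis
  then show False
    using G by simp
qed

text \<open>Pythagoras: with \<open>p\<close> the projection of \<open>x\<close>, the vector
  \<open>x - p\<close> is orthogonal to the span of \<open>F\<close>, hence to
  \<open>p - s\<close>.\<close>

lemma norm_minus_projection_le:
  assumes F: "orthonormal F" "finite F" and s: "s \<in> complex_vector.span F"
  shows "norm (x - (\<Sum>f\<in>F. cinner x f *\<^sub>C f)) \<le> norm (x - s)"
proof -
  define p where "p = (\<Sum>f\<in>F. cinner x f *\<^sub>C f)"
  have "p - s \<in> complex_vector.span F"
    unfolding p_def by (intro complex_vector.span_diff complex_vector.span_sum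
        complex_vector.span_scale complex_vector.span_base s)
  then obtain c where c: "p - s = (\<Sum>f\<in>F. c f *\<^sub>C f)"
    using complex_vector.span_finite [OF F(2)] by auto
  have "cinner (x - p) f = 0" if "f \<in> F" for f
    using cinner_sum_orthonormal [OF F that] by (simp add: p_def cinner_diff_left)
  then have 0: "cinner (x - p) (p - s) = 0"
    unfolding c cinner_sum_right by (simp add: cinner_linear)
  then have 1: "cinner (p - s) (x - p) = 0"
    by (metis cinner_commute complex_cnj_zero)
  have "cinner (x - s) (x - s) = cinner ((x - p) + (p - s)) ((x - p) + (p - s))"
    by simp
  also have "\<dots> = cinner (x - p) (x - p) + cinner (p - s) (p - s)"
    unfolding cinner_add_left cinner_add_right 0 1 by simp
  finally have "(norm (x - s))\<^sup>2 = (norm (x - p))\<^sup>2 + (norm (p - s))\<^sup>2"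
    unfolding cinner_self by (metis of_real_add of_real_eq_iff)
  then have "(norm (x - p))\<^sup>2 \<le> (norm (x - s))\<^sup>2"
    by simp
  then show ?thesis
    unfolding p_def [symmetric] by (rule power2_le_imp_le) simp
qed

text \<open>By density some finite combination of basis vectors is close to \<open>x\<close>. The
  projection onto any larger finite subfamily is at least as close, and Cauchy-Schwarz bounds the
  error of the partial sum.\<close>

lemma Parseval_has_sum:
  assumes B: "is_orthonormal_basis B"
  shows "((\<lambda>b. cinner x b * cinner b y) has_sum cinner x y) B"
  unfolding has_sum_def tendsto_iff eventually_finite_subsets_at_top
proof (intro allI impI)
  fix e :: real assume "e > 0"
  \<comment> \<open>The summand 1 keeps the denominator positive when \<open>y = 0\<close>.\<close>
  define d where "d = e / (norm y + 1)"
  have "d > 0"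
    using \<open>e > 0\<close> by (simp add: d_def add_nonneg_pos)
  have "x \<in> closure (complex_vector.span B)"
    using B by (simp add: is_orthonormal_basis_def)
  then obtain s where s: "s \<in> complex_vector.span B" "dist s x < d"
    using \<open>d > 0\<close> by (meson closure_approachable)
  then obtain G r where G: "finite G" "G \<subseteq> B" and "s = (\<Sum>a\<in>G. r a *\<^sub>C a)"
    unfolding complex_vector.span_explicit by blast
  then have "s \<in> complex_vector.span G"
    by (simp add: complex_vector.span_sum complex_vector.span_scale complex_vector.span_base)
  have "dist (\<Sum>b\<in>F. cinner x b * cinner b y) (cinner x y) < e"
    if F: "finite F" "G \<subseteq> F" "F \<subseteq> B" for F
  proof -
    define p where "p = (\<Sum>f\<in>F. cinner x f *\<^sub>C f)"
    have "orthonormal F"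
      using orthonormal_subset [OF is_orthonormal_basis_imp_orthonormal [OF B] F(3)] .
    then have "norm (x - p) \<le> norm (x - s)"
      unfolding p_def
      using F(1) \<open>s \<in> complex_vector.span G\<close> complex_vector.span_mono [OF F(2)]
      by (intro norm_minus_projection_le) (assumption | erule (1) subsetD [rotated])+
    then have "norm (x - p) < d"
      using s by (simp add: dist_norm norm_minus_commute)
    have "cinner x y - (\<Sum>b\<in>F. cinner x b * cinner b y) = cinner (x - p) y"
      by (simp add: p_def cinner_sum_left cinner_linear)
    then have "dist (\<Sum>b\<in>F. cinner x b * cinner b y) (cinner x y) = norm (cinner (x - p) y)"
      by (subst dist_commute) (simp only: dist_norm)
    also have "\<dots> \<le> norm (x - p) * norm y"
      by (rule norm_cinner_le)
    also have "\<dots> \<le> d * norm y"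
      using \<open>norm (x - p) < d\<close> by (intro mult_right_mono) auto
    also have "\<dots> < d * (norm y + 1)"
      using \<open>d > 0\<close> by simp
    also have "\<dots> = e"
      using norm_ge_zero [of y] by (simp add: d_def add_nonneg_eq_0_iff)
    finally show ?thesis .
  qed
  then show "\<exists>X. finite X \<and> X \<subseteq> B \<and> (\<forall>Y. finite Y \<and> X \<subseteq> Y \<and> Y \<subseteq> B \<longrightarrow>
      dist (\<Sum>b\<in>Y. cinner x b * cinner b y) (cinner x y) < e)"
    using G by (intro exI [of _ G] conjI allI impI) auto
qed

text \<open>Leaving the trace as a definite description spares the existence of an orthonormal basis:
  what matters is that it depends on the number \<open>k * cinner x y\<close> only.\<close>

lemma op_trace_scaled_rank_one:
  fixes x y :: "'a::chilbert_space"
  shows "op_trace (\<lambda>a. k *\<^sub>C rank_one x y a) =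
     (THE t. \<forall>B::'a set. is_orthonormal_basis B \<longrightarrow> t = k * cinner x y)"
proof -
  have *: "((\<lambda>b. cinner (k *\<^sub>C rank_one x y b) b) has_sum (k * cinner x y)) B"
    if "is_orthonormal_basis B" for B :: "'a set"
  proof -
    have "cinner (k *\<^sub>C rank_one x y b) b = k * (cinner x b * cinner b y)" for b
      by (simp add: rank_one_def cinner_linear)
    then show ?thesis
      using has_sum_cmult_right [OF Parseval_has_sum [OF that, of x y], of k] by presburger
  qed
  have "((\<lambda>b. cinner (k *\<^sub>C rank_one x y b) b) has_sum t) B \<longleftrightarrow> t = k * cinner x y"
    if "is_orthonormal_basis B" for t and B :: "'a set"
    using has_sum_unique [OF _ * [OF that], of t] * [OF that] by (intro iffI) simp_all
  then have "(\<forall>B. is_orthonormal_basis B \<longrightarrow>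
        ((\<lambda>b. cinner (k *\<^sub>C rank_one x y b) b) has_sum t) B) \<longleftrightarrow>
      (\<forall>B::'a set. is_orthonormal_basis B \<longrightarrow> t = k * cinner x y)" for t
    by (simp only: cong: imp_cong)
  then show ?thesis
    by (simp only: op_trace_def)
qed

section \<open>Schatten norms of diagonalised operators\<close>

text \<open>The spectral form sought for \<open>cadjoint A \<circ> A\<close>; it vanishes on the
  orthogonal complement of \<open>F\<close>.\<close>

definition diag_op :: "'a::chilbert_space set \<Rightarrow> ('a \<Rightarrow> real) \<Rightarrow> 'a \<Rightarrow> 'a" where
  "diag_op F a z = (\<Sum>f\<in>F. (complex_of_real (a f) * cinner z f) *\<^sub>C f)"

lemma bounded_clinear_diag_op: "bounded_clinear (diag_op F a)"
  unfolding bounded_clinear_def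
proof
  have "diag_op F a = (\<lambda>z. \<Sum>f\<in>F. a f *\<^sub>R rank_one f f z)"
    by (simp add: diag_op_def rank_one_def scaleR_scaleC scaleC_scaleC fun_eq_iff)
  then show "bounded_linear (diag_op F a)"
    by (simp add: bounded_linear_sum bounded_linear_const_scaleR bounded_linear_rank_one)
  show "\<forall>c x. diag_op F a (c *\<^sub>C x) = c *\<^sub>C diag_op F a x"
    by (simp add: diag_op_def cinner_linear complex_vector.scale_sum_right scaleC_scaleC
        mult.left_commute)
qed

lemma positive_diag_op:
  assumes "\<And>f. f \<in> F \<Longrightarrow> 0 \<le> a f"
  shows "positive_op (diag_op F a)"
proof -
  have "cinner (diag_op F a z) z = of_real (\<Sum>f\<in>F. a f * (cmod (cinner z f))\<^sup>2)" for z
  proof -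
    have "cinner z f * cinner f z = of_real ((cmod (cinner z f))\<^sup>2)" for f
      using cinner_commute [of f z] by (metis complex_norm_square)
    then show ?thesis
      by (simp add: diag_op_def cinner_sum_left cinner_linear mult.assoc)
  qed
  moreover have "0 \<le> (\<Sum>f\<in>F. a f * (cmod (cinner z f))\<^sup>2)" for z
    using assms by (intro sum_nonneg) auto
  ultimately show ?thesis
    by (simp add: positive_op_def bounded_clinear_diag_op)
qed

context
  fixes F :: "'a::chilbert_space set"
  assumes F: "orthonormal F" "finite F"
begin

lemma cinner_diag_op: "f \<in> F \<Longrightarrow> cinner (diag_op F a z) f = of_real (a f) * cinner z f"
  unfolding diag_op_def by (rule cinner_sum_orthonormal [OF F])

lemma diag_op_diag_op: "diag_op F a (diag_op F b z) = diag_op F (\<lambda>f. a f * b f) z"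
  by (subst (1 3) diag_op_def) (simp add: cinner_diag_op mult.assoc)

lemma diag_op_basis: "f \<in> F \<Longrightarrow> diag_op F a f = of_real (a f) *\<^sub>C f"
proof -
  assume f: "f \<in> F"
  have "diag_op F a f = (\<Sum>g\<in>F. if g = f then of_real (a f) *\<^sub>C f else 0)"
    unfolding diag_op_def using f F by (intro sum.cong) (auto simp: orthonormal_cinner)
  then show ?thesis
    using f F by simp
qed

text \<open>Uniqueness of the positive square root, by hand: \<open>P\<close> is determined on each
  \<open>f\<close> in \<open>F\<close>, and it vanishes wherever its square does, in particular on
  the orthogonal complement of \<open>F\<close>.\<close>

lemma positive_sqrt_diag_op:
  assumes a: "\<And>f. f \<in> F \<Longrightarrow> 0 \<le> a f" and P: "positive_op P" "P \<circ> P = diag_op F a"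
  shows "P = diag_op F (\<lambda>f. sqrt (a f))"
proof
  fix z
  have lin: "linear P" and scale: "P (c *\<^sub>C x) = c *\<^sub>C P x" for x c
    using P by (auto simp: positive_op_def bounded_clinear_def bounded_linear.linear)
  have PP: "P (P x) = diag_op F a x" for x
    using P(2) by (metis comp_apply)
  have ker: "P x = 0" if "diag_op F a x = 0" for x
  proof -
    have "cinner (P x) (P x) = cinner (P (P x)) x"
      using positive_op_self_adjoint [OF P(1)] by metis
    then show ?thesis
      using that by (simp add: PP cinner_eq_zero_iff)
  qed
  have Pf: "P f = of_real (sqrt (a f)) *\<^sub>C f" if f: "f \<in> F" for f
  proof (cases "a f = 0")
    case True
    then show ?thesis
      using f ker by (simp add: diag_op_basis)
  next
    case False
    define s where "s = sqrt (a f)"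
    have s: "s > 0" "s * s = a f"
      using a [OF f] False by (auto simp: s_def)
    \<comment> \<open>Since \<open>P (P f) = a f f\<close>, applying \<open>P + s\<close> to
      \<open>g\<close> gives 0. So \<open>g\<close> satisfies \<open>P g = - s g\<close>, which
      positivity allows only for \<open>g = 0\<close>.\<close>
    define g where "g = P f - of_real s *\<^sub>C f"
    have "P g = of_real (s * s) *\<^sub>C f - of_real s *\<^sub>C P f"
      by (simp only: g_def linear_diff [OF lin] scale PP diag_op_basis [OF f] s)
    also have "\<dots> = of_real (- s) *\<^sub>C g"
      by (simp add: g_def complex_vector.scale_right_diff_distrib scaleC_scaleC)
    finally have "cinner (P g) g = of_real (- s * (norm g)\<^sup>2)"
      by (simp add: cinner_linear cinner_minus_left cinner_self)
    moreover have "0 \<le> Re (cinner (P g) g)"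
      using P(1) by (simp add: positive_op_def)
    ultimately have "s * (norm g)\<^sup>2 \<le> 0"
      by simp
    then have "g = 0"
      using s(1) by (metis mult_le_0_iff not_less zero_less_norm_iff zero_less_power)
    then show ?thesis
      by (simp add: g_def s_def)
  qed
  \<comment> \<open>The projection of \<open>z\<close> onto the span of \<open>F\<close>; the
    remainder \<open>z - q\<close> lies in the kernel.\<close>
  define q where "q = (\<Sum>f\<in>F. cinner z f *\<^sub>C f)"
  have "diag_op F a (z - q) = 0"
    unfolding diag_op_def cinner_diff_left q_def
    by (intro sum.neutral) (simp add: cinner_sum_orthonormal [OF F])
  then have "P (z - q) = 0"
    by (rule ker)
  then have "P z = P q"
    by (simp add: linear_diff [OF lin])
  also have "\<dots> = diag_op F (\<lambda>f. sqrt (a f)) z"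
    unfolding q_def linear_sum [OF lin] diag_op_def
    by (intro sum.cong) (auto simp: scale Pf scaleC_scaleC mult.commute)
  finally show "P z = diag_op F (\<lambda>f. sqrt (a f)) z" .
qed

lemma op_modulus_diag_op:
  assumes a: "\<And>f. f \<in> F \<Longrightarrow> 0 \<le> a f" and A: "cadjoint A \<circ> A = diag_op F a"
  shows "op_modulus A = diag_op F (\<lambda>f. sqrt (a f))"
  unfolding op_modulus_def A
proof (rule the_equality)
  have "diag_op F (\<lambda>f. sqrt (a f)) (diag_op F (\<lambda>f. sqrt (a f)) z) = diag_op F a z" for z
    unfolding diag_op_diag_op unfolding diag_op_def by (intro sum.cong) (auto simp: a)
  then show "positive_op (diag_op F (\<lambda>f. sqrt (a f))) \<and>
      diag_op F (\<lambda>f. sqrt (a f)) \<circ> diag_op F (\<lambda>f. sqrt (a f)) = diag_op F a"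
    using a by (auto intro!: positive_diag_op)
qed (use a positive_sqrt_diag_op in blast)

text \<open>Comparing coefficients kills those with \<open>a f \<noteq> s\<close>; dividing by
  \<open>s\<close> then expresses \<open>z\<close> through the rest. For \<open>s = 0\<close> the
  eigenspace would also contain the orthogonal complement of \<open>F\<close>.\<close>

lemma diag_op_eigenspace:
  assumes "s \<noteq> 0"
  shows "{z. diag_op F a z = of_real s *\<^sub>C z} = complex_vector.span {f \<in> F. a f = s}"
    (is "?E = complex_vector.span ?G")
proof
  show "?E \<subseteq> complex_vector.span ?G"
  proof
    fix z assume "z \<in> ?E"
    then have z: "diag_op F a z = of_real s *\<^sub>C z"
      by simp
    have 0: "cinner z f = 0" if "f \<in> F" "a f \<noteq> s" for f
      using cinner_diag_op [OF that(1), of a z] that(2) by (simp add: z cinner_linear)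
    have "of_real s *\<^sub>C z = (\<Sum>f\<in>?G. (of_real (a f) * cinner z f) *\<^sub>C f)"
      unfolding z [symmetric] diag_op_def
      by (rule sum.mono_neutral_right) (use F 0 in auto)
    then have "of_real s *\<^sub>C z \<in> complex_vector.span ?G"
      by (auto intro: complex_vector.span_sum complex_vector.span_scale complex_vector.span_base)
    then have "inverse (of_real s) *\<^sub>C of_real s *\<^sub>C z \<in> complex_vector.span ?G"
      by (rule complex_vector.span_scale)
    then show "z \<in> complex_vector.span ?G"
      using assms by (simp add: scaleC_scaleC)
  qed
  have lin: "diag_op F a (x + y) = diag_op F a x + diag_op F a y"
      "diag_op F a (c *\<^sub>C x) = c *\<^sub>C diag_op F a x" "diag_op F a 0 = 0" for c x y
    using bounded_clinear_diag_op [of F a] by (auto simp: bounded_clinear_def linear_simps)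
  have "complex_vector.subspace ?E"
    by (auto simp: complex_vector.subspace_def lin scaleC_add_right scaleC_scaleC mult.commute)
  then show "complex_vector.span ?G \<subseteq> ?E"
    by (intro complex_vector.span_minimal) (auto simp: diag_op_basis)
qed

lemma schatten_norm_diag_op:
  assumes a: "\<And>f. f \<in> F \<Longrightarrow> 0 \<le> a f" and A: "cadjoint A \<circ> A = diag_op F a"
  shows "schatten_norm p A = (\<Sum>f\<in>F. sqrt (a f) powr p) powr (1 / p)"
proof -
  define G where "G s = {f \<in> F. sqrt (a f) = s}" for s
  have E: "{x. op_modulus A x = of_real s *\<^sub>C x} = complex_vector.span (G s)" if "s > 0" for s
    using that by (simp add: op_modulus_diag_op [OF a A] diag_op_eigenspace G_def)
  have on: "orthonormal (G s)" for s
    using F(1) orthonormal_subset [of F "G s"] by (auto simp: G_def)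
  have mult: "singular_value_mult A s = card (G s)" if "s > 0" for s
    unfolding singular_value_mult_def E [OF that]
    by (rule complex_vector.dim_span_eq_card_independent [OF orthonormal_independent [OF on]])
  have "singular_values A = {s. 0 < s \<and> G s \<noteq> {}}"
  proof -
    have "(\<exists>x. x \<noteq> 0 \<and> x \<in> complex_vector.span (G s)) \<longleftrightarrow> G s \<noteq> {}" for s
    proof
      assume "G s \<noteq> {}"
      then obtain f where f: "f \<in> G s"
        by blast
      then have "norm f = 1"
        using on by (simp add: orthonormal_def)
      then show "\<exists>x. x \<noteq> 0 \<and> x \<in> complex_vector.span (G s)"
        using f complex_vector.span_base by force
    qed auto
    moreover have "(op_modulus A x = of_real s *\<^sub>C x) \<longleftrightarrow> x \<in> complex_vector.span (G s)"
      if "s > 0" for s x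
      using E [OF that] by blast
    ultimately show ?thesis
      unfolding singular_values_def by (intro Collect_cong conj_cong) auto
  qed
  also have "\<dots> = (\<lambda>f. sqrt (a f)) ` {f \<in> F. a f > 0}"
    by (auto simp: G_def)
  finally have S: "singular_values A = (\<lambda>f. sqrt (a f)) ` {f \<in> F. a f > 0}" .
  then have fin: "finite (singular_values A)"
    using F by simp
  have "(\<Sum>\<^sub>\<infinity>s\<in>singular_values A. real (singular_value_mult A s) * s powr p)
      = (\<Sum>s\<in>singular_values A. real (card (G s)) * s powr p)"
    using mult fin by (simp add: singular_values_def)
  \<comment> \<open>Each singular value is spread over the indices producing it, so that the double
    sum can be merged.\<close>
  also have "\<dots> = (\<Sum>s\<in>singular_values A.
      \<Sum>f\<in>{f \<in> {f \<in> F. a f > 0}. sqrt (a f) = s}. sqrt (a f) powr p)"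
  proof (rule sum.cong)
    fix s assume "s \<in> singular_values A"
    then have "s > 0"
      by (simp add: singular_values_def)
    then have "{f \<in> {f \<in> F. a f > 0}. sqrt (a f) = s} = G s"
      by (auto simp: G_def)
    then show "real (card (G s)) * s powr p
        = (\<Sum>f\<in>{f \<in> {f \<in> F. a f > 0}. sqrt (a f) = s}. sqrt (a f) powr p)"
      by (simp add: G_def)
  qed simp
  also have "\<dots> = (\<Sum>f\<in>{f \<in> F. a f > 0}. sqrt (a f) powr p)"
    using F by (intro sum.group) (auto simp: S)
  \<comment> \<open>Indices with \<open>a f = 0\<close> may be restored because
    \<open>0 powr p = 0\<close>.\<close>
  also have "\<dots> = (\<Sum>f\<in>F. sqrt (a f) powr p)"
    using F a by (intro sum.mono_neutral_left) (auto simp: less_le)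
  finally show ?thesis
    by (simp add: schatten_norm_def)
qed

end

section \<open>Operators of rank at most two\<close>

lemma orthonormal_pair:
  "f \<noteq> g \<Longrightarrow> orthonormal {f, g} \<longleftrightarrow> norm f = 1 \<and> norm g = 1 \<and> cinner f g = 0"
  using cinner_commute [of g f] by (auto simp: orthonormal_def)

lemma cinner_rank_one_rank_one:
  "cinner (rank_one u x a) b = cinner a (rank_one x u b)"
  using cinner_commute [of b u] by (simp add: rank_one_def cinner_linear)

lemma cadjoint_rank_one: "cadjoint (rank_one u x) = rank_one x u"
  by (rule cadjoint_eqI) (rule cinner_rank_one_rank_one)

text \<open>The spectral theorem for the positive semidefinite matrix with rows \<open>m, c\<close>
  and \<open>cnj c, n\<close> relative to \<open>f, g\<close>. The eigenvalues are the roots of the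
  characteristic polynomial; trace and determinant make them non-negative.\<close>

lemma hermitian_pair_diag_op:
  fixes f g :: "'a::chilbert_space" and c :: complex and m n :: real
  assumes fg: "norm f = 1" "norm g = 1" "cinner f g = 0"
    and tr: "0 \<le> m + n" and det: "(cmod c)\<^sup>2 \<le> m * n"
  obtains u v a b where "u \<noteq> v" "orthonormal {u, v}" "0 \<le> a" "0 \<le> b" "a + b = m + n"
    "a * b = m * n - (cmod c)\<^sup>2"
    "\<And>z. (of_real m * cinner z f + c * cinner z g) *\<^sub>C f
        + (cnj c * cinner z f + of_real n * cinner z g) *\<^sub>C g
      = diag_op {u, v} (\<lambda>w. if w = u then a else b) z"
\<comment> \<open>A diagonal matrix is treated apart, since the eigenvector normalised below may
  then vanish.\<close>
proof (cases "c = 0")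
  case True
  have "f \<noteq> g"
    using fg by (auto simp: cinner_self)
  moreover have "0 \<le> m \<and> 0 \<le> n"
    using tr det True by (auto simp: zero_le_mult_iff)
  ultimately show thesis
    using that [of f g m n] fg True by (auto simp: orthonormal_pair diag_op_def)
next
  case False
  define r where "r = sqrt ((m - n)\<^sup>2 + 4 * (cmod c)\<^sup>2)"
  define a where "a = (m + n + r) / 2"
  define b where "b = (m + n - r) / 2"
  define d where "d = a - m"
  have r2: "r\<^sup>2 = (m - n)\<^sup>2 + 4 * (cmod c)\<^sup>2"
    by (simp add: r_def)
  then have "r\<^sup>2 \<le> (m + n)\<^sup>2"
    using det by (simp add: power2_eq_square algebra_simps)
  then have "r \<le> m + n"
    using tr by (rule power2_le_imp_le)
  moreover have "0 \<le> r"
    by (simp add: r_def)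
  ultimately have ab: "0 \<le> a" "0 \<le> b"
    using tr by (simp_all add: a_def b_def)
  have sum: "a + b = m + n"
    by (simp add: a_def b_def field_simps)
  have prod: "a * b = m * n - (cmod c)\<^sup>2"
    using r2 by (simp add: a_def b_def power2_eq_square field_simps)
  \<comment> \<open>The characteristic polynomial \<open>(t - a) (t - b)\<close> evaluated at
    \<open>t = m\<close> equals \<open>- (cmod c)^2\<close>.\<close>
  have c2: "(cmod c)\<^sup>2 = d * (m - b)"
    using prod sum unfolding d_def by algebra
  define N where "N = sqrt ((cmod c)\<^sup>2 + d\<^sup>2)"
  have N2: "N * N = d * (a - b)"
  proof -
    have "N * N = d * (m - b) + d\<^sup>2"
      by (simp add: N_def flip: c2)
    then show ?thesis
      by (simp add: d_def power2_eq_square algebra_simps)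
  qed
  have "N > 0"
    using False by (simp add: N_def add_pos_nonneg)
  \<comment> \<open>\<open>c f + (a - m) g\<close>, normalised, is an eigenvector for the root \<open>a\<close> of the characteristic
    polynomial.\<close>
  define C D :: complex where "C = c / of_real N" and "D = of_real d / of_real N"
  have CC: "C * cnj C = of_real (d * (m - b) / (N * N))"
    by (simp add: C_def flip: c2 of_real_cmod_power2)
  have DD: "D * D = of_real (d * d / (N * N))"
    by (simp add: D_def)
  have [simp]: "cnj D = D"
    by (simp add: D_def)
  have norm1: "C * cnj C + D * D = 1"
  proof -
    have "d * (m - b) + d * d = N * N"
      by (simp add: N2 d_def algebra_simps)
    then show ?thesis
      unfolding CC DD of_real_add [symmetric] add_divide_distrib [symmetric]
      using \<open>N > 0\<close> by simp
  qed
  \<comment> \<open>The \<open>entry\<close> identities say that \<open>a\<close> times the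
    projection onto \<open>C f + D g\<close> plus \<open>b\<close> times the projection onto
    \<open>cnj C g - D f\<close> has the given matrix.\<close>
  have entry_m: "of_real a * (C * cnj C) + of_real b * (D * D) = of_real m"
  proof -
    have "a * (d * (m - b)) + b * (d * d) = m * (N * N)"
      unfolding N2 d_def by algebra
    then have "a * (d * (m - b) / (N * N)) + b * (d * d / (N * N)) = m"
      using \<open>N > 0\<close> by (simp add: divide_simps)
    then show ?thesis
      unfolding CC DD by (metis of_real_add of_real_mult)
  qed
  have entry_n: "of_real a * (D * D) + of_real b * (C * cnj C) = of_real n"
  proof -
    have "n = a + b - m"
      using sum by simp
    then have "complex_of_real n = of_real a + of_real b - of_real m"
      by simp
    then show ?thesis
      using entry_m norm1 by algebra
  qed
  have entry_c: "of_real (a - b) * (C * D) = c"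
  proof -
    have "of_real (a - b) * (C * D) = c * of_real (d * (a - b)) / of_real (N * N)"
      by (simp add: C_def D_def)
    then show ?thesis
      using \<open>N > 0\<close> by (simp flip: N2)
  qed
  then have entry_cnj: "of_real (a - b) * (cnj C * D) = cnj c"
    by (metis \<open>cnj D = D\<close> complex_cnj_complex_of_real complex_cnj_mult)
  have gf: "cinner g f = 0"
    using fg(3) cinner_commute [of g f] by simp
  define u where "u = C *\<^sub>C f + D *\<^sub>C g"
  define v where "v = cnj C *\<^sub>C g - D *\<^sub>C f"
  have "cinner u u = 1" "cinner v v = 1" and uv0: "cinner u v = 0"
    using norm1 fg(3) gf cinner_self [of f] cinner_self [of g]
    by (simp_all add: fg(1,2) u_def v_def cinner_linear algebra_simps)
  then have uv: "norm u = 1" "norm v = 1"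
    by (simp_all add: cinner_self power2_eq_1_iff del: of_real_power flip: of_real_power)
      (use norm_ge_zero [of u] norm_ge_zero [of v] in linarith)+
  have "u \<noteq> v"
    using uv uv0 by (auto simp: cinner_self)
  have "diag_op {u, v} (\<lambda>w. if w = u then a else b) z =
      (of_real m * cinner z f + c * cinner z g) *\<^sub>C f
        + (cnj c * cinner z f + of_real n * cinner z g) *\<^sub>C g" for z
  proof -
    define s where "s = of_real a * cinner z u"
    define t where "t = of_real b * cinner z v"
    have "s * C - t * D = of_real m * cinner z f + c * cinner z g"
      unfolding s_def t_def u_def v_def entry_m [symmetric] entry_c [symmetric]
      by (simp add: cinner_linear algebra_simps)
    moreover have "s * D + t * cnj C = cnj c * cinner z f + of_real n * cinner z g"
      unfolding s_def t_def u_def v_def entry_n [symmetric] entry_cnj [symmetric]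
      by (simp add: cinner_linear algebra_simps)
    moreover have "diag_op {u, v} (\<lambda>w. if w = u then a else b) z = s *\<^sub>C u + t *\<^sub>C v"
      using \<open>u \<noteq> v\<close> by (simp add: diag_op_def s_def t_def)
    moreover have "s *\<^sub>C u + t *\<^sub>C v = (s * C - t * D) *\<^sub>C f + (s * D + t * cnj C) *\<^sub>C g"
      by (simp add: u_def v_def scaleC_add_right scaleC_scaleC scaleC_add_left
          complex_vector.scale_left_diff_distrib complex_vector.scale_right_diff_distrib)
    ultimately show ?thesis
      by simp
  qed
  then show thesis
    using that [of u v a b] \<open>u \<noteq> v\<close> uv uv0 ab sum prod by (simp add: orthonormal_pair)
qed

text \<open>The operator \<open>cadjoint A \<circ> A\<close> lives on the span of \<open>x\<close>
  and \<open>y\<close>, where \<open>a + b\<close> is its trace and \<open>a * b\<close> its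
  determinant, namely the product of the Gram determinants of \<open>u, w\<close> and of
  \<open>x, y\<close>.\<close>

lemma schatten_norm_rank_one_diff:
  fixes u w x y :: "'a::chilbert_space" and l :: complex
  assumes unit: "norm u = 1" "norm w = 1" "norm x = 1" "norm y = 1" and l: "cmod l = 1"
  obtains a b where "0 \<le> a" "0 \<le> b" "a + b = 2 - 2 * Re (cnj l * (cinner w u * cinner x y))"
    "a * b = (1 - (cmod (cinner w u))\<^sup>2) * (1 - (cmod (cinner x y))\<^sup>2)"
    "\<forall>p. schatten_norm p (\<lambda>z. l *\<^sub>C rank_one u x z - rank_one w y z)
      = (a powr (p / 2) + b powr (p / 2)) powr (1 / p)"
proof -
  define A where "A = (\<lambda>z. l *\<^sub>C rank_one u x z - rank_one w y z)"
  define \<alpha> where "\<alpha> = cinner w u"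
  define \<beta> where "\<beta> = cinner x y"
  define \<gamma> where "\<gamma> = cnj l * \<alpha>"
  have sqrt_powr: "sqrt a powr p = a powr (p / 2)" if "0 \<le> a" for a p :: real
    using that by (simp add: powr_half_sqrt [symmetric] powr_powr)
  have \<alpha>1: "cmod \<alpha> \<le> 1" and \<beta>1: "cmod \<beta> \<le> 1"
    using norm_cinner_le [of w u] norm_cinner_le [of x y] unit by (simp_all add: \<alpha>_def \<beta>_def)
  have \<gamma>\<alpha>: "cmod \<gamma> = cmod \<alpha>"
    using l by (simp add: \<gamma>_def norm_mult)
  have "cmod (\<gamma> * \<beta>) \<le> 1"
    using \<alpha>1 \<beta>1 by (simp add: norm_mult \<gamma>\<alpha> mult_le_one)
  then have t0: "0 \<le> 2 - 2 * Re (\<gamma> * \<beta>)"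
    using complex_Re_le_cmod [of "\<gamma> * \<beta>"] by linarith
  have yx: "cinner y x = cnj \<beta>" and uw: "cinner u w = cnj \<alpha>"
    unfolding \<alpha>_def \<beta>_def by (rule cinner_commute)+
  have ll: "l * cnj l = 1"
    using l by (simp flip: complex_norm_square)
  have "cadjoint A = (\<lambda>z. cnj l *\<^sub>C rank_one x u z - rank_one y w z)"
    unfolding A_def
    by (rule cadjoint_eqI) (simp add: cinner_linear cinner_rank_one_rank_one)
  then have cadj: "cadjoint A z = cnj l *\<^sub>C rank_one x u z - rank_one y w z" for z
    by simp
  have T: "(cadjoint A \<circ> A) z = (cinner z x - \<gamma> * cinner z y) *\<^sub>C x
      + (cinner z y - cnj \<gamma> * cinner z x) *\<^sub>C y" for z
  proof -
    have "cinner (A z) u = l * cinner z x - \<alpha> * cinner z y"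
      using unit by (simp add: A_def rank_one_def cinner_linear cinner_self \<alpha>_def)
    then have "cnj l * cinner (A z) u = cinner z x - \<gamma> * cinner z y"
      using ll by (simp add: \<gamma>_def) algebra
    moreover have "- cinner (A z) w = cinner z y - cnj \<gamma> * cinner z x"
      using unit by (simp add: A_def rank_one_def cinner_linear cinner_self uw \<gamma>_def)
    moreover have "(cadjoint A \<circ> A) z = (cnj l * cinner (A z) u) *\<^sub>C x + (- cinner (A z) w) *\<^sub>C y"
      by (simp add: cadj rank_one_def scaleC_scaleC)
    ultimately show ?thesis
      by simp
  qed
  have Re_\<gamma>\<beta>: "complex_of_real (2 * Re (\<gamma> * \<beta>)) = \<gamma> * \<beta> + cnj \<gamma> * cnj \<beta>"
    using complex_add_cnj [of "\<gamma> * \<beta>"] by simp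
  show thesis
  proof (cases "y = cnj \<beta> *\<^sub>C x")
    \<comment> \<open>Here \<open>x\<close> and \<open>y\<close> are parallel, so only one
      eigenvalue \<open>k\<close> can be non-zero; the second number is 0, matching
      \<open>cmod \<beta> = 1\<close> in the product.\<close>
    case True
    define k where "k = 2 - 2 * Re (\<gamma> * \<beta>)"
    have \<beta>2: "cmod \<beta> = 1"
      using unit norm_scaleC [of "cnj \<beta>" x] True by simp
    have zy: "cinner z y = \<beta> * cinner z x" for z
      by (subst True) (simp add: cinner_linear)
    have "(cadjoint A \<circ> A) z = diag_op {x} (\<lambda>_. k) z" for z
    proof -
      have "\<beta> * cnj \<beta> = 1"
        using \<beta>2 by (simp flip: of_real_cmod_power2)
      then have "of_real k * cinner z x
          = (cinner z x - \<gamma> * cinner z y) + (cinner z y - cnj \<gamma> * cinner z x) * cnj \<beta>"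
        unfolding k_def of_real_diff Re_\<gamma>\<beta> zy by (simp add: algebra_simps)
      moreover have "(cadjoint A \<circ> A) z = (cinner z x - \<gamma> * cinner z y) *\<^sub>C x
          + (cinner z y - cnj \<gamma> * cinner z x) *\<^sub>C cnj \<beta> *\<^sub>C x"
        unfolding T True [symmetric] by (rule refl)
      ultimately show ?thesis
        by (simp add: diag_op_def scaleC_scaleC scaleC_add_left)
    qed
    then have "cadjoint A \<circ> A = diag_op {x} (\<lambda>_. k)"
      by blast
    then have "schatten_norm p A = (sqrt k powr p) powr (1 / p)" for p
      using t0 unit by (subst schatten_norm_diag_op [of "{x}" "\<lambda>_. k"])
        (auto simp: orthonormal_def k_def)
    then show thesis
      using that [of k 0] t0 \<beta>2
      by (simp add: k_def \<gamma>_def \<alpha>_def \<beta>_def A_def mult.assoc sqrt_powr)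
  next
    case False
    \<comment> \<open>Gram-Schmidt: \<open>x, g\<close> is an orthonormal basis of the span of
      \<open>x\<close> and \<open>y\<close>.\<close>
    define \<rho> where "\<rho> = norm (y - cnj \<beta> *\<^sub>C x)"
    define g where "g = of_real (inverse \<rho>) *\<^sub>C (y - cnj \<beta> *\<^sub>C x)"
    have "\<rho> > 0"
      using False by (simp add: \<rho>_def)
    have xg: "cinner x g = 0"
      using unit by (simp add: g_def cinner_linear cinner_self \<beta>_def)
    have g1: "norm g = 1"
      using \<open>\<rho> > 0\<close> by (simp add: g_def norm_scaleC norm_inverse flip: \<rho>_def)
    have y: "y = cnj \<beta> *\<^sub>C x + of_real \<rho> *\<^sub>C g"
      using \<open>\<rho> > 0\<close> by (simp add: g_def scaleC_scaleC)
    have "complex_of_real (\<rho>\<^sup>2) = cinner (y - cnj \<beta> *\<^sub>C x) (y - cnj \<beta> *\<^sub>C x)"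
      by (simp only: \<rho>_def cinner_self)
    also have "\<dots> = of_real (1 - (cmod \<beta>)\<^sup>2)"
      using unit \<beta>_def
      by (simp add: cinner_linear cinner_self [of x] cinner_self [of y] yx of_real_cmod_power2)
    finally have \<rho>2: "\<rho>\<^sup>2 = 1 - (cmod \<beta>)\<^sup>2"
      using of_real_eq_iff by blast
    \<comment> \<open>In the basis \<open>x, g\<close> the matrix of
      \<open>cadjoint A \<circ> A\<close> has diagonal entries \<open>m\<close>,
      \<open>\<rho>^2\<close> and off-diagonal entries \<open>c\<close>,
      \<open>cnj c\<close>.\<close>
    define m where "m = 1 + (cmod \<beta>)\<^sup>2 - 2 * Re (\<gamma> * \<beta>)"
    define c where "c = of_real \<rho> * (cnj \<beta> - \<gamma>)"
    have "(cmod (cnj \<beta> - \<gamma>))\<^sup>2 = (cmod \<beta>)\<^sup>2 + (cmod \<gamma>)\<^sup>2 - 2 * Re (\<gamma> * \<beta>)"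
      unfolding cmod_power2 by (simp add: power2_eq_square algebra_simps)
    then have det: "m * \<rho>\<^sup>2 - (cmod c)\<^sup>2 = (1 - (cmod \<alpha>)\<^sup>2) * (1 - (cmod \<beta>)\<^sup>2)"
      by (simp add: m_def c_def norm_mult power_mult_distrib \<gamma>\<alpha> \<rho>2) (simp add: algebra_simps)
    have "0 \<le> (1 - (cmod \<alpha>)\<^sup>2) * (1 - (cmod \<beta>)\<^sup>2)"
      using \<alpha>1 \<beta>1 by (simp add: power_le_one)
    then have "(cmod c)\<^sup>2 \<le> m * \<rho>\<^sup>2" "0 \<le> m + \<rho>\<^sup>2"
      using det t0 by (simp_all add: m_def \<rho>2)
    then obtain f h a b where fh: "f \<noteq> h" "orthonormal {f, h}" and ab: "0 \<le> a" "0 \<le> b"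
        "a + b = m + \<rho>\<^sup>2" "a * b = m * \<rho>\<^sup>2 - (cmod c)\<^sup>2"
      and diag: "\<And>z. (of_real m * cinner z x + c * cinner z g) *\<^sub>C x
          + (cnj c * cinner z x + of_real (\<rho>\<^sup>2) * cinner z g) *\<^sub>C g
        = diag_op {f, h} (\<lambda>w. if w = f then a else b) z"
      using hermitian_pair_diag_op [of x g m "\<rho>\<^sup>2" c] unit g1 xg by metis
    have zy: "cinner z y = \<beta> * cinner z x + of_real \<rho> * cinner z g" for z
      by (subst y) (simp add: cinner_linear)
    have "(cadjoint A \<circ> A) z = (of_real m * cinner z x + c * cinner z g) *\<^sub>C x
          + (cnj c * cinner z x + of_real (\<rho>\<^sup>2) * cinner z g) *\<^sub>C g" for z
    proof -
      have "of_real m * cinner z x + c * cinner z g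
          = (cinner z x - \<gamma> * cinner z y) + (cinner z y - cnj \<gamma> * cinner z x) * cnj \<beta>"
        unfolding m_def of_real_diff Re_\<gamma>\<beta> zy c_def
        by (simp add: of_real_cmod_power2 algebra_simps)
      moreover have "cnj c * cinner z x + of_real (\<rho>\<^sup>2) * cinner z g
          = (cinner z y - cnj \<gamma> * cinner z x) * of_real \<rho>"
        unfolding zy c_def by (simp add: power2_eq_square algebra_simps)
      moreover have "(cadjoint A \<circ> A) z = (cinner z x - \<gamma> * cinner z y) *\<^sub>C x
          + (cinner z y - cnj \<gamma> * cinner z x) *\<^sub>C (cnj \<beta> *\<^sub>C x + of_real \<rho> *\<^sub>C g)"
        unfolding T y [symmetric] by (rule refl)
      ultimately show ?thesis
        by (simp add: scaleC_add_right scaleC_scaleC scaleC_add_left)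
    qed
    then have "cadjoint A \<circ> A = diag_op {f, h} (\<lambda>w. if w = f then a else b)"
      using diag by (intro ext) metis
    then have "schatten_norm p A = (sqrt a powr p + sqrt b powr p) powr (1 / p)" for p
      using ab fh by (subst schatten_norm_diag_op [of "{f, h}" "\<lambda>w. if w = f then a else b"]) auto
    then show thesis
      using that [of a b] ab det
      by (simp add: m_def \<rho>2 \<gamma>_def \<alpha>_def \<beta>_def A_def mult.assoc sqrt_powr)
  qed
qed

section \<open>Power sums of two numbers\<close>

lemma powr_left_inj:
  fixes a b q :: real
  assumes "0 \<le> a" "0 \<le> b" "0 < q" "a powr q = b powr q"
  shows "a = b"
proof -
  have "(a powr q) powr (1 / q) = (b powr q) powr (1 / q)"
    by (simp add: assms(4))
  then show ?thesis
    using assms(1-3) by (simp add: powr_powr)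
qed

text \<open>Both pairs are the roots of the same monic quadratic polynomial.\<close>

lemma sum_prod_eq_imp_swap:
  fixes a b a' b' :: "'a::idom"
  assumes "a + b = a' + b'" "a * b = a' * b'"
  shows "a = a' \<and> b = b' \<or> a = b' \<and> b = a'"
proof -
  have "(a - a') * (a - b') = 0"
    using assms by algebra
  then show ?thesis
    using assms(1) by (auto simp: add.commute)
qed

text \<open>The \<open>q\<close>-th powers have the same sum and product, hence agree up to order.\<close>

lemma powr_sum_prod_eq_imp_sum_eq:
  fixes a b a' b' q :: real
  assumes "0 \<le> a" "0 \<le> b" "0 \<le> a'" "0 \<le> b'" "0 < q"
    and "a * b = a' * b'" and "a powr q + b powr q = a' powr q + b' powr q"
  shows "a + b = a' + b'"
proof -
  have "a powr q * b powr q = a' powr q * b' powr q"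
    using assms by (simp flip: powr_mult)
  with assms(7) have "a powr q = a' powr q \<and> b powr q = b' powr q
      \<or> a powr q = b' powr q \<and> b powr q = a' powr q"
    by (rule sum_prod_eq_imp_swap)
  then show ?thesis
    using assms powr_left_inj by (metis add.commute)
qed

text \<open>Rolle's theorem: equal values would force a zero of the derivative strictly between
  \<open>s\<close> and \<open>t\<close>, yet for \<open>q \<noteq> 1\<close> the derivative vanishes
  only at 0. The case \<open>t = 1\<close> is covered because continuity suffices at the end
  points.\<close>

lemma powr_symmetric_sum_neq:
  fixes s t q :: real
  assumes "0 < q" "q \<noteq> 1" "0 \<le> s" "s < t" "t \<le> 1"
  shows "(1 + s) powr q + (1 - s) powr q \<noteq> (1 + t) powr q + (1 - t) powr q"
proof
  let ?h = "\<lambda>z::real. (1 + z) powr q + (1 - z) powr q"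
  assume "?h s = ?h t"
  have deriv: "(?h has_real_derivative q * (1 + z) powr (q - 1) - q * (1 - z) powr (q - 1)) (at z)"
    if "s < z" "z < t" for z
    using that assms by (auto intro!: derivative_eq_intros)
  have "continuous_on {s..t} ?h"
    using assms by (intro continuous_intros continuous_on_powr') auto
  then obtain z where z: "s < z" "z < t" "(?h has_real_derivative 0) (at z)"
    using Rolle [of s t ?h] \<open>?h s = ?h t\<close> \<open>s < t\<close> deriv real_differentiable_def by blast
  then have "q * (1 + z) powr (q - 1) - q * (1 - z) powr (q - 1) = 0"
    using deriv DERIV_unique by blast
  \<comment> \<open>Logarithms reduce the equation to \<open>ln (1 + z) = ln (1 - z)\<close>, which
    fails for \<open>0 < z < 1\<close>.\<close>
  then have "ln ((1 + z) powr (q - 1)) = ln ((1 - z) powr (q - 1))"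
    using assms by simp
  then show False
    using z assms by (simp add: ln_powr)
qed

text \<open>Centred at the mean, a pair is \<open>1 + s, 1 - s\<close> with
  \<open>s = \<bar>a - 1\<bar>\<close> up to order. The power sum determines \<open>s\<close>, and
  the product is \<open>1 - s^2\<close>.\<close>

lemma powr_sum_eq_imp_prod_eq:
  fixes a b a' b' q :: real
  assumes "0 \<le> a" "0 \<le> b" "a + b = 2" "0 \<le> a'" "0 \<le> b'" "a' + b' = 2" "0 < q" "q \<noteq> 1"
    and eq: "a powr q + b powr q = a' powr q + b' powr q"
  shows "a * b = a' * b'"
proof -
  let ?h = "\<lambda>s::real. (1 + s) powr q + (1 - s) powr q"
  have h: "a powr q + b powr q = ?h \<bar>a - 1\<bar> \<and> a * b = 1 - \<bar>a - 1\<bar>\<^sup>2 \<and> \<bar>a - 1\<bar> \<le> 1"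
    if "0 \<le> a" "0 \<le> b" "a + b = 2" for a b :: real
  proof -
    have b: "b = 2 - a" and "a \<le> 2"
      using that by simp_all
    then show ?thesis
      using \<open>0 \<le> a\<close> unfolding b
      by (cases "1 \<le> a") (simp_all add: power2_eq_square algebra_simps)
  qed
  have "\<bar>a - 1\<bar> = \<bar>a' - 1\<bar>"
    using powr_symmetric_sum_neq [of q "\<bar>a - 1\<bar>" "\<bar>a' - 1\<bar>"]
      powr_symmetric_sum_neq [of q "\<bar>a' - 1\<bar>" "\<bar>a - 1\<bar>"] h [of a b] h [of a' b'] assms
    by (metis abs_ge_zero linorder_neqE)
  then show ?thesis
    using h [of a b] h [of a' b'] assms by metis
qed

text \<open>The numerical core, free of operators: \<open>\<phi> l\<close> stands for the
  \<open>p\<close>-th power of the Schatten norm and \<open>q\<close> for \<open>p / 2\<close>. It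
  is essential that \<open>d\<close> and \<open>d'\<close> are the same for all
  \<open>l\<close>.\<close>

lemma eq_if_powr_sums_eq:
  fixes q d d' :: real and \<tau> \<tau>' :: complex and \<phi> \<phi>' :: "complex \<Rightarrow> real"
  assumes "0 < q"
    and P: "\<forall>l. cmod l = 1 \<longrightarrow> (\<exists>a b. 0 \<le> a \<and> 0 \<le> b \<and> a + b = 2 - 2 * Re (cnj l * \<tau>) \<and>
      a * b = d \<and> \<phi> l = a powr q + b powr q)"
    and P': "\<forall>l. cmod l = 1 \<longrightarrow> (\<exists>a b. 0 \<le> a \<and> 0 \<le> b \<and> a + b = 2 - 2 * Re (cnj l * \<tau>') \<and>
      a * b = d' \<and> \<phi>' l = a powr q + b powr q)"
    and \<phi>: "\<And>l. cmod l = 1 \<Longrightarrow> \<phi> l = \<phi>' l"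
  shows "\<tau> = \<tau>'"
proof -
  have choice: "\<exists>a b. \<forall>l. cmod l = 1 \<longrightarrow> Q l (a l) (b l)"
    if "\<forall>l. cmod l = 1 \<longrightarrow> (\<exists>a b. Q l a b)" for Q :: "complex \<Rightarrow> real \<Rightarrow> real \<Rightarrow> bool"
    using that by metis
  obtain a b where ab: "\<And>l. cmod l = 1 \<Longrightarrow> 0 \<le> a l \<and> 0 \<le> b l \<and>
      a l + b l = 2 - 2 * Re (cnj l * \<tau>) \<and> a l * b l = d \<and> \<phi> l = a l powr q + b l powr q"
    using choice [OF P] by blast
  obtain a' b' where ab': "\<And>l. cmod l = 1 \<Longrightarrow> 0 \<le> a' l \<and> 0 \<le> b' l \<and>
      a' l + b' l = 2 - 2 * Re (cnj l * \<tau>') \<and> a' l * b' l = d' \<and> \<phi>' l = a' l powr q + b' l powr q"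
    using choice [OF P'] by blast
  have eq: "a l powr q + b l powr q = a' l powr q + b' l powr q" if "cmod l = 1" for l
    using ab [OF that] ab' [OF that] \<phi> [OF that] by simp
  \<comment> \<open>The phase of \<open>\<tau>\<close>; for \<open>\<tau> = 0\<close> any unit
    number would do.\<close>
  define \<omega> where "\<omega> = (if \<tau> = 0 then 1 else sgn \<tau>)"
  have \<omega>: "cmod \<omega> = 1" "\<tau> = of_real (cmod \<tau>) * \<omega>"
    by (auto simp: \<omega>_def sgn_eq norm_divide)
  have \<omega>2: "cnj \<omega> * \<omega> = 1"
    using \<omega>(1) by (metis complex_norm_square mult.commute of_real_1 one_power2)
  let ?l = "\<i> * \<omega>"
  have l: "cmod ?l = 1" "cmod (- ?l) = 1"
    using \<omega> by (simp_all add: norm_mult)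
  have "cnj \<omega> * \<tau> = of_real (cmod \<tau>)"
    by (subst \<omega>(2)) (simp add: \<omega>2 mult.left_commute)
  then have \<tau>0: "Re (cnj ?l * \<tau>) = 0" and \<tau>1: "Re (cnj \<omega> * \<tau>) = cmod \<tau>"
    by (simp_all add: mult.assoc)
  \<comment> \<open>For the first pair sum and product determine the power sum; for the second, the
    power sum and the product then give back the sum.\<close>
  have "a ?l + b ?l = a (- ?l) + b (- ?l)" "a ?l * b ?l = a (- ?l) * b (- ?l)"
    using ab [OF l(1)] ab [OF l(2)] \<tau>0 by simp_all
  then have "a ?l powr q + b ?l powr q = a (- ?l) powr q + b (- ?l) powr q"
    using sum_prod_eq_imp_swap [of "a ?l" "b ?l" "a (- ?l)" "b (- ?l)"] by auto
  then have "a' ?l powr q + b' ?l powr q = a' (- ?l) powr q + b' (- ?l) powr q"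
    unfolding eq [OF l(1)] eq [OF l(2)] .
  moreover have "a' ?l * b' ?l = a' (- ?l) * b' (- ?l)"
    using ab' [OF l(1)] ab' [OF l(2)] by argo
  ultimately have "a' ?l + b' ?l = a' (- ?l) + b' (- ?l)"
    using ab' [OF l(1)] ab' [OF l(2)] \<open>0 < q\<close>
      powr_sum_prod_eq_imp_sum_eq [of "a' ?l" "b' ?l" "a' (- ?l)" "b' (- ?l)" q] by blast
  then have "Re (cnj ?l * \<tau>') = Re (cnj (- ?l) * \<tau>')"
    using ab' [OF l(1)] ab' [OF l(2)] by argo
  then have \<tau>'0: "Re (cnj ?l * \<tau>') = 0"
    by (simp add: algebra_simps)
  have "Re (cnj \<omega> * \<tau>) = Re (cnj \<omega> * \<tau>')"
  proof (cases "q = 1")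
    case True
    \<comment> \<open>The power sum is now the sum itself, so the products need not be
      compared.\<close>
    then have "a \<omega> + b \<omega> = a' \<omega> + b' \<omega>"
      using ab [OF \<omega>(1)] ab' [OF \<omega>(1)] eq [OF \<omega>(1)] by simp
    then show ?thesis
      using ab [OF \<omega>(1)] ab' [OF \<omega>(1)] by argo
  next
    case False
    have "a ?l * b ?l = a' ?l * b' ?l"
    proof (rule powr_sum_eq_imp_prod_eq)
      show "a ?l + b ?l = 2" "a' ?l + b' ?l = 2"
        using ab [OF l(1)] ab' [OF l(1)] \<tau>0 \<tau>'0 by argo+
    qed (use ab [OF l(1)] ab' [OF l(1)] eq [OF l(1)] \<open>0 < q\<close> False in blast)+
    \<comment> \<open>The equality \<open>d = d'\<close> found at \<open>?l\<close> is carried over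
      to \<open>\<omega>\<close>.\<close>
    then have "a \<omega> * b \<omega> = a' \<omega> * b' \<omega>"
      using ab [OF l(1)] ab' [OF l(1)] ab [OF \<omega>(1)] ab' [OF \<omega>(1)] by argo
    then have "a \<omega> + b \<omega> = a' \<omega> + b' \<omega>"
      using ab [OF \<omega>(1)] ab' [OF \<omega>(1)] eq [OF \<omega>(1)] \<open>0 < q\<close>
        powr_sum_prod_eq_imp_sum_eq [of "a \<omega>" "b \<omega>" "a' \<omega>" "b' \<omega>" q] by blast
    then show ?thesis
      using ab [OF \<omega>(1)] ab' [OF \<omega>(1)] by argo
  qed
  \<comment> \<open>As \<open>cnj ?l = - \<i> * cnj \<omega>\<close>, real parts at
    \<open>?l\<close> are imaginary parts at \<open>\<omega>\<close>, and both are 0.\<close>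
  moreover have "Im (cnj \<omega> * \<tau>) = Im (cnj \<omega> * \<tau>')"
    using \<tau>0 \<tau>'0 by (simp add: algebra_simps)
  ultimately have "cnj \<omega> * \<tau> = cnj \<omega> * \<tau>'"
    by (simp add: complex_eq_iff)
  then show "\<tau> = \<tau>'"
    using \<omega>(1) by auto
qed

theorem lemma3p4:
  fixes p :: real and e v e' v' :: "'h::chilbert_space \<Rightarrow> 'h"
  assumes "0 < p"
    and "e \<in> min_partial_isometries" and "v \<in> min_partial_isometries"
    and "e' \<in> min_partial_isometries" and "v' \<in> min_partial_isometries"
    and "\<And>l::complex. norm l = 1 \<Longrightarrow>
      schatten_norm p (\<lambda>a. l *\<^sub>C e a - v a) = schatten_norm p (\<lambda>a. l *\<^sub>C e' a - v' a)"
  shows "op_trace (cadjoint e \<circ> v) = op_trace (cadjoint e' \<circ> v')"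
proof -
  define q where "q = p / 2"
  have "q > 0"
    using assms(1) by (simp add: q_def)
  \<comment> \<open>Stated for an arbitrary pair so that it serves both. The trace enters only as a
    description in terms of \<open>\<tau>\<close>, so equality of the two numbers is all that
    remains.\<close>
  have rep: "\<exists>\<tau> d. op_trace (cadjoint e \<circ> v) =
        (THE t. \<forall>B::'h set. is_orthonormal_basis B \<longrightarrow> t = \<tau>) \<and>
      (\<forall>l. cmod l = 1 \<longrightarrow> (\<exists>a b. 0 \<le> a \<and> 0 \<le> b \<and> a + b = 2 - 2 * Re (cnj l * \<tau>) \<and> a * b = d \<and>
        schatten_norm p (\<lambda>a. l *\<^sub>C e a - v a) powr p = a powr q + b powr q))"
    if ev: "e \<in> min_partial_isometries" "v \<in> min_partial_isometries" for e v :: "'h \<Rightarrow> 'h"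
  proof -
    obtain u x where e: "e = rank_one u x" "norm u = 1" "norm x = 1"
      using ev(1) by (auto simp: min_partial_isometries_def)
    obtain w y where v: "v = rank_one w y" "norm w = 1" "norm y = 1"
      using ev(2) by (auto simp: min_partial_isometries_def)
    have "cadjoint e \<circ> v = (\<lambda>a. cinner w u *\<^sub>C rank_one x y a)"
      by (simp add: e v cadjoint_rank_one fun_eq_iff)
        (simp add: rank_one_def cinner_linear scaleC_scaleC mult.commute)
    then have "op_trace (cadjoint e \<circ> v) =
        (THE t. \<forall>B::'h set. is_orthonormal_basis B \<longrightarrow> t = cinner w u * cinner x y)"
      by (simp only: op_trace_scaled_rank_one)
    moreover have "\<exists>a b. 0 \<le> a \<and> 0 \<le> b \<and> a + b = 2 - 2 * Re (cnj l * (cinner w u * cinner x y)) \<and>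
        a * b = (1 - (cmod (cinner w u))\<^sup>2) * (1 - (cmod (cinner x y))\<^sup>2) \<and>
        schatten_norm p (\<lambda>a. l *\<^sub>C e a - v a) powr p = a powr q + b powr q"
      if l: "cmod l = 1" for l
    proof -
      obtain a b where ab: "0 \<le> a" "0 \<le> b"
          "a + b = 2 - 2 * Re (cnj l * (cinner w u * cinner x y))"
          "a * b = (1 - (cmod (cinner w u))\<^sup>2) * (1 - (cmod (cinner x y))\<^sup>2)"
        and "\<forall>p. schatten_norm p (\<lambda>z. l *\<^sub>C rank_one u x z - rank_one w y z)
          = (a powr (p / 2) + b powr (p / 2)) powr (1 / p)"
        using schatten_norm_rank_one_diff [OF e(2) v(2) e(3) v(3) l] by blast
      then have "schatten_norm p (\<lambda>a. l *\<^sub>C e a - v a) powr p = a powr q + b powr q"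
        using assms(1) by (simp add: e(1) v(1) powr_powr q_def)
      with ab show ?thesis
        by (intro exI [of _ a] exI [of _ b] conjI)
    qed
    ultimately show ?thesis
      by blast
  qed
  obtain \<tau> d where \<tau>: "op_trace (cadjoint e \<circ> v) =
        (THE t. \<forall>B::'h set. is_orthonormal_basis B \<longrightarrow> t = \<tau>)"
      and P: "\<forall>l. cmod l = 1 \<longrightarrow> (\<exists>a b. 0 \<le> a \<and> 0 \<le> b \<and> a + b = 2 - 2 * Re (cnj l * \<tau>) \<and> a * b = d \<and>
        schatten_norm p (\<lambda>a. l *\<^sub>C e a - v a) powr p = a powr q + b powr q)"
    using rep [OF assms(2,3)] by blast
  obtain \<tau>' d' where \<tau>': "op_trace (cadjoint e' \<circ> v') =
        (THE t. \<forall>B::'h set. is_orthonormal_basis B \<longrightarrow> t = \<tau>')"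
      and P': "\<forall>l. cmod l = 1 \<longrightarrow> (\<exists>a b. 0 \<le> a \<and> 0 \<le> b \<and> a + b = 2 - 2 * Re (cnj l * \<tau>') \<and> a * b = d' \<and>
        schatten_norm p (\<lambda>a. l *\<^sub>C e' a - v' a) powr p = a powr q + b powr q)"
    using rep [OF assms(4,5)] by blast
  have "\<tau> = \<tau>'"
    using \<open>q > 0\<close> P P' by (rule eq_if_powr_sums_eq) (simp add: assms(6))
  then show ?thesis
    using \<tau> \<tau>' by simp
qed

end
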